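(* Let $k\geq 2$ be an even integer and let $x\in\{k-2,k\}$. Then the complete bipartite graph $K_{k-1,x}$ admits a $P_k$-decomposition.
   Context: $P_k$ denotes the path with $k$ vertices and $k-1$ edges. $K_{m,n}$ is the complete bipartite graph with parts of size $m$ and $n$. A $\Gamma$-decomposition of a graph $K$ is a set of subgraphs of $K$, each isomorphic to $\Gamma$, whose edge sets partition the edge set of $K$. *)

theory Defs
  imports Main "HOL-Library.Disjoint_Sets"
begin

record 'a ugraph =
  verts :: "'a set"
  edges :: "'a set set"

definition simple_graph :: "'a ugraph \<Rightarrow> bool" where
  "simple_graph G \<longleftrightarrow> (\<forall>e\<in>edges G. e \<subseteq> verts G \<and> card e = 2)"

definition subgraph_of :: "'a ugraph \<Rightarrow> 'a ugraph \<Rightarrow> bool" where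
  "subgraph_of H G \<longleftrightarrow> simple_graph H \<and> verts H \<subseteq> verts G \<and> edges H \<subseteq> edges G"

definition isomorphic :: "'a ugraph \<Rightarrow> 'b ugraph \<Rightarrow> bool" where
  "isomorphic G H \<longleftrightarrow>
     (\<exists>f. bij_betw f (verts G) (verts H) \<and>
          (\<forall>u\<in>verts G. \<forall>v\<in>verts G. {u, v} \<in> edges G \<longleftrightarrow> {f u, f v} \<in> edges H))"

definition path_graph :: "nat \<Rightarrow> nat ugraph" where
  "path_graph k = \<lparr>verts = {..<k}, edges = {{i, Suc i} | i. Suc i < k}\<rparr>"

definition complete_bipartite :: "nat \<Rightarrow> nat \<Rightarrow> (nat + nat) ugraph" where
  "complete_bipartite m n =
     \<lparr>verts = {..<m} <+> {..<n}, edges = {{Inl i, Inr j} | i j. i < m \<and> j < n}\<rparr>"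

(* Injectivity of edges on D excludes two members of D sharing an edge set,
   which the image in partition_on alone would not detect. *)
definition is_decomposition :: "'b ugraph \<Rightarrow> 'a ugraph \<Rightarrow> 'a ugraph set \<Rightarrow> bool" where
  "is_decomposition \<Gamma> K D \<longleftrightarrow>
     (\<forall>H\<in>D. subgraph_of H K \<and> isomorphic H \<Gamma>) \<and>
     inj_on edges D \<and> partition_on (edges K) (edges ` D)"

lemma simple_graph_path_graph: "simple_graph (path_graph k)"
  by (auto simp: simple_graph_def path_graph_def)

lemma simple_graph_complete_bipartite: "simple_graph (complete_bipartite m n)"
  by (auto simp: simple_graph_def complete_bipartite_def)

end

theory Submission
  imports Defs
begin

text \<open>
  Put \<open>k = 2 m\<close>. The closed zigzags \<open>b\<^sub>j a\<^sub>c\<^sub>-\<^sub>j b\<^sub>j\<^sub>+\<^sub>1 a\<^sub>c\<^sub>-\<^sub>j\<^sub>-\<^sub>1 \<dots>\<close> with even \<open>c\<close> and indices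
  modulo an even number \<open>n\<close> decompose \<open>K\<^sub>n\<^sub>,\<^sub>n\<close> into Hamiltonian cycles. For \<open>n = k\<close>, deleting one
  vertex \<open>a\<close> opens every cycle to a path of length \<open>2 (k - 1)\<close>, which is cut in the middle.
  For \<open>n = k - 2\<close>, every cycle is cut at two opposite vertices \<open>b\<close>, \<open>b'\<close>, and the
  two halves are prolonged by the edges from \<open>b\<close> and from \<open>b'\<close> to an additional vertex
  \<open>a\<^sub>\<infinity>\<close>; cutting the cycles at successive positions uses every edge at \<open>a\<^sub>\<infinity>\<close> once.
  In both cases it suffices to see that the paths cover all edges, since the number of edges is right.
\<close>

section \<open>Covering families of paths as decompositions\<close>

lemma isomorphic_path_graph:
  assumes inj: "inj_on g {..<k}"
  shows "isomorphic \<lparr>verts = g ` {..<k}, edges = {{g i, g (Suc i)} | i. Suc i < k}\<rparr> (path_graph k)"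
    (is "isomorphic ?H _")
proof -
  let ?f = "inv_into {..<k} g"
  have g: "g a = g b \<longleftrightarrow> a = b" if "a < k" "b < k" for a b
    using inj that by (auto simp: inj_on_def)
  have f: "?f (g a) = a" if "a < k" for a
    using inj that by simp
  have "bij_betw ?f (verts ?H) (verts (path_graph k))"
    using inj by (simp add: path_graph_def bij_betw_inv_into inj_on_imp_bij_betw)
  moreover have "{g a, g b} \<in> edges ?H \<longleftrightarrow> {a, b} \<in> edges (path_graph k)" if "a < k" "b < k" for a b
  proof -
    have "{g a, g b} = {g i, g (Suc i)} \<longleftrightarrow> {a, b} = {i, Suc i}" if "Suc i < k" for i
      using g \<open>a < k\<close> \<open>b < k\<close> that by (simp add: doubleton_eq_iff)
    then show ?thesis
      by (auto simp: path_graph_def)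
  qed
  ultimately show ?thesis
    unfolding isomorphic_def by (intro exI[of _ ?f]) (auto simp: f)
qed

text \<open>Disjointness comes from counting: the pairs of a path and a position map onto the edges,
  and by \<open>card\<close> both sets have the same size, so no edge is hit twice.\<close>

lemma path_decomposition_if_cover:
  fixes g :: "'i \<Rightarrow> nat \<Rightarrow> 'a"
  assumes "2 \<le> k" and "finite P"
    and inj: "\<And>p. p \<in> P \<Longrightarrow> inj_on (g p) {..<k}"
    and verts: "\<And>p i. p \<in> P \<Longrightarrow> i < k \<Longrightarrow> g p i \<in> verts K"
    and edges: "\<And>p i. p \<in> P \<Longrightarrow> Suc i < k \<Longrightarrow> {g p i, g p (Suc i)} \<in> edges K"
    and cover: "\<And>e. e \<in> edges K \<Longrightarrow> \<exists>p\<in>P. \<exists>i. Suc i < k \<and> e = {g p i, g p (Suc i)}"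
    and card: "card (edges K) = card P * (k - 1)"
  shows "\<exists>D. is_decomposition (path_graph k) K D"
proof -
  define E where "E p = {{g p i, g p (Suc i)} | i. Suc i < k}" for p
  define H where "H p = \<lparr>verts = g p ` {..<k}, edges = E p\<rparr>" for p
  define S where "S = P \<times> {..<k - 1}"
  define h where "h = (\<lambda>(p, i). {g p i, g p (Suc i)})"
  have "h ` S = edges K"
    using edges cover by (fastforce simp: S_def h_def)
  with card have "inj_on h S"
    using \<open>finite P\<close> by (intro eq_card_imp_inj_on) (auto simp: S_def card_cartesian_product)
  have unique: "p = q" if pq: "p \<in> P" "q \<in> P" and e: "e \<in> E p" "e \<in> E q" for p q e
  proof -
    obtain i j where "i < k - 1" "j < k - 1" "h (p, i) = e" "h (q, j) = e"
      using e by (auto simp: E_def h_def less_diff_conv)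
    with pq have "(p, i) = (q, j)"
      by (intro inj_onD[OF \<open>inj_on h S\<close>]) (simp_all add: S_def)
    then show "p = q" by simp
  qed
  \<comment> \<open>Since a shared edge identifies two paths, this also yields injectivity of
    \<open>edges\<close> on the family.\<close>
  have nonempty: "E p \<noteq> {}" for p
    using \<open>2 \<le> k\<close> unfolding E_def by (auto intro!: exI[of _ 0])
  have sub: "subgraph_of (H p) K" if p: "p \<in> P" for p
  proof -
    have "card {g p i, g p (Suc i)} = 2" if "Suc i < k" for i
      using inj_onD[OF inj[OF p], of i "Suc i"] that by (auto simp: card_insert_if)
    then show ?thesis
      using verts[OF p] edges[OF p]
      by (auto simp: subgraph_of_def simple_graph_def H_def E_def)
  qed
  have iso: "isomorphic (H p) (path_graph k)" if "p \<in> P" for p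
    unfolding H_def E_def using inj[OF that] by (rule isomorphic_path_graph)
  have "inj_on edges (H ` P)"
  proof (rule inj_onI)
    fix X Y
    assume "X \<in> H ` P" "Y \<in> H ` P" and eq: "edges X = edges Y"
    then obtain p q where pq: "p \<in> P" "q \<in> P" "X = H p" "Y = H q"
      by blast
    with eq have "E p = E q"
      by (simp add: H_def)
    with nonempty[of p] pq unique show "X = Y"
      by blast
  qed
  moreover have "partition_on (edges K) (edges ` H ` P)"
  proof -
    have "edges ` H ` P = E ` P"
      by (simp add: image_image H_def)
    moreover have "partition_on (edges K) (E ` P)"
    proof (rule partition_onI)
      show "\<Union> (E ` P) = edges K"
        using edges cover by (fastforce simp: E_def)
      show "{} \<notin> E ` P"
        using nonempty by force
      show "disjnt A B" if "A \<in> E ` P" "B \<in> E ` P" "A \<noteq> B" for A B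
        using that unique unfolding disjnt_iff by blast
    qed
    ultimately show ?thesis
      by simp
  qed
  ultimately have "is_decomposition (path_graph k) K (H ` P)"
    using sub iso by (auto simp: is_decomposition_def)
  then show ?thesis ..
qed

section \<open>Alternating paths in complete bipartite graphs\<close>

lemma card_edges_complete_bipartite: "card (edges (complete_bipartite m n)) = m * n"
proof -
  have "edges (complete_bipartite m n) = (\<lambda>(i, j). {Inl i, Inr j}) ` ({..<m} \<times> {..<n})"
    by (auto simp: complete_bipartite_def)
  moreover have "inj_on (\<lambda>(i, j). {Inl i, Inr j}) ({..<m} \<times> {..<n})"
    by (auto simp: inj_on_def doubleton_eq_iff)
  ultimately show ?thesis
    by (simp add: card_image card_cartesian_product)
qed

text \<open>The \<open>p\<close>-th path visits \<open>\<alpha> p 0, \<beta> p 0, \<alpha> p 1, \<beta> p 1, \<dots>\<close>, alternating between the two sides.\<close>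
lemma complete_bipartite_path_decompositionI:
  fixes \<alpha> \<beta> :: "nat \<Rightarrow> nat \<Rightarrow> nat"
  assumes "0 < m"
    and inj_\<alpha>: "\<And>p. p < n \<Longrightarrow> inj_on (\<alpha> p) {..<m}"
    and inj_\<beta>: "\<And>p. p < n \<Longrightarrow> inj_on (\<beta> p) {..<m}"
    and \<alpha>: "\<And>p j. p < n \<Longrightarrow> j < m \<Longrightarrow> \<alpha> p j < 2 * m - 1"
    and \<beta>: "\<And>p j. p < n \<Longrightarrow> j < m \<Longrightarrow> \<beta> p j < n"
    and cover: "\<And>i q. i < 2 * m - 1 \<Longrightarrow> q < n \<Longrightarrow>
      \<exists>p<n. \<exists>j. j < m \<and> \<alpha> p j = i \<and> \<beta> p j = q \<or> Suc j < m \<and> \<alpha> p (Suc j) = i \<and> \<beta> p j = q"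
  shows "\<exists>D. is_decomposition (path_graph (2 * m)) (complete_bipartite (2 * m - 1) n) D"
proof -
  define g where "g p i = (if even i then Inl (\<alpha> p (i div 2)) else Inr (\<beta> p (i div 2)))" for p i
  have g_even: "g p (2 * j) = Inl (\<alpha> p j)" and g_odd: "g p (Suc (2 * j)) = Inr (\<beta> p j)" for p j
    by (simp_all add: g_def)
  show ?thesis
  proof (rule path_decomposition_if_cover[where P = "{..<n}" and g = g])
    show "inj_on (g p) {..<2 * m}" if "p \<in> {..<n}" for p
    proof (rule inj_onI)
      fix i j
      assume ij: "i \<in> {..<2 * m}" "j \<in> {..<2 * m}" "g p i = g p j"
      then have "i div 2 < m" "j div 2 < m"
        by auto
      with ij that inj_\<alpha>[of p] inj_\<beta>[of p] have "even i \<longleftrightarrow> even j" "i div 2 = j div 2"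
        by (auto simp: g_def inj_on_def split: if_splits)
      then show "i = j"
        by (metis bit_eq_rec)
    qed
    show "g p i \<in> verts (complete_bipartite (2 * m - 1) n)" if "p \<in> {..<n}" "i < 2 * m" for p i
    proof -
      have "i div 2 < m"
        using that by auto
      then show ?thesis
        using that \<alpha> \<beta> by (auto simp: g_def complete_bipartite_def)
    qed
    show "{g p i, g p (Suc i)} \<in> edges (complete_bipartite (2 * m - 1) n)"
      if "p \<in> {..<n}" "Suc i < 2 * m" for p i
    proof (cases "even i")
      case True
      then obtain j where "i = 2 * j" ..
      with that \<alpha>[of p j] \<beta>[of p j] show ?thesis
        by (auto simp: g_even g_odd complete_bipartite_def)
    next
      case False
      then obtain j where "i = Suc (2 * j)"
        by (auto elim: oddE)
      with that \<alpha>[of p "Suc j"] \<beta>[of p j] g_even[of p "Suc j"] show ?thesis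
        by (auto simp: g_odd complete_bipartite_def insert_commute)
    qed
    show "\<exists>p\<in>{..<n}. \<exists>i. Suc i < 2 * m \<and> e = {g p i, g p (Suc i)}"
      if e: "e \<in> edges (complete_bipartite (2 * m - 1) n)" for e
    proof -
      obtain a b where ab: "e = {Inl a, Inr b}" "a < 2 * m - 1" "b < n"
        using e by (auto simp: complete_bipartite_def)
      obtain p j where p: "p < n"
        and "j < m \<and> \<alpha> p j = a \<and> \<beta> p j = b \<or> Suc j < m \<and> \<alpha> p (Suc j) = a \<and> \<beta> p j = b"
        using cover[OF ab(2,3)] by blast
      then consider "j < m" "\<alpha> p j = a" "\<beta> p j = b" | "Suc j < m" "\<alpha> p (Suc j) = a" "\<beta> p j = b"
        by blast
      then have "\<exists>i. Suc i < 2 * m \<and> e = {g p i, g p (Suc i)}"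
      proof cases
        case 1
        then show ?thesis
          using ab(1) by (intro exI[of _ "2 * j"]) (simp add: g_even g_odd)
      next
        case 2
        then show ?thesis
          using ab(1) g_even[of p "Suc j"]
          by (intro exI[of _ "Suc (2 * j)"]) (simp add: g_odd insert_commute)
      qed
      with p show ?thesis
        by blast
    qed
  \<comment> \<open>The count is right: \<open>n\<close> paths with \<open>2 * m - 1\<close> edges
    each.\<close>
  qed (use \<open>0 < m\<close> in \<open>auto simp: card_edges_complete_bipartite\<close>)
qed

section \<open>Rotations and reflections modulo n\<close>

lemma inj_on_add_mod: "inj_on (\<lambda>j. (p + j) mod n) {..<n::nat}"
proof (rule inj_onI)
  fix i j
  assume ij: "i \<in> {..<n}" "j \<in> {..<n}" and "(p + i) mod n = (p + j) mod n"
  \<comment> \<open>Adding \<open>n - p mod n\<close>, the negative of \<open>p\<close> modulo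
    \<open>n\<close>, undoes the shift.\<close>
  then have "(p + i + (n - p mod n)) mod n = (p + j + (n - p mod n)) mod n"
    by (metis mod_add_left_eq)
  moreover have "(p + i + (n - p mod n)) mod n = i" if "i < n" for i
  proof -
    have "p + i + (n - p mod n) = i + n * (p div n + 1)"
      using that mult_div_mod_eq[of n p] mod_less_divisor[of n p] unfolding distrib_left by linarith
    then show ?thesis
      using that by (simp only: mod_mult_self2 mod_less)
  qed
  ultimately show "i = j"
    using ij by simp
qed

text \<open>Here \<open>n - j\<close> stands for \<open>-j\<close> modulo \<open>n\<close>. Adding
  \<open>i + j\<close> to both values swaps the indices and reduces the claim to a rotation.\<close>

lemma inj_on_diff_mod: "inj_on (\<lambda>j. (p + (n - j)) mod n) {..<n::nat}"
proof (rule inj_onI)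
  fix i j
  assume ij: "i \<in> {..<n}" "j \<in> {..<n}" and "(p + (n - i)) mod n = (p + (n - j)) mod n"
  then have "(p + (n - i) + (i + j)) mod n = (p + (n - j) + (i + j)) mod n"
    by (metis mod_add_left_eq)
  moreover have "p + (n - i) + (i + j) = p + j + n" "p + (n - j) + (i + j) = p + i + n"
    using ij by auto
  ultimately have "(p + i) mod n = (p + j) mod n"
    by (metis mod_add_self2)
  then show "i = j"
    using inj_onD[OF inj_on_add_mod[of p n] _ ij(1,2)] by blast
qed

section \<open>The case x = k\<close>

text \<open>
  The deleted vertex is the one opposite to \<open>m - 1\<close>, so each opened cycle has \<open>m - 1\<close> in its middle.
  Its two halves both start there, the even one running down to \<open>0\<close>, the odd one up to \<open>2 m - 2\<close>.
\<close>
lemma complete_bipartite_path_decomposition: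
  assumes "0 < m"
  shows "\<exists>D. is_decomposition (path_graph (2 * m)) (complete_bipartite (2 * m - 1) (2 * m)) D"
proof -
  define n where "n = 2 * m"
  define \<alpha> where "\<alpha> p j = (if even p then m - Suc j else m - 1 + j)" for p j :: nat
  \<comment> \<open>Along path \<open>p\<close> the two indices of an edge add up, modulo
    \<open>n\<close>, to \<open>p + m - 1\<close> or \<open>p + m - 2\<close> for even
    \<open>p\<close>, and to \<open>p + m - 1\<close> or \<open>p + m\<close> for odd
    \<open>p\<close>. So an even \<open>p\<close> and its predecessor modulo \<open>n\<close> are
    the two halves of one cycle.\<close>
  define \<beta> where "\<beta> p j = (if even p then (p + j) mod n else (p + (n - j)) mod n)" for p j :: nat
  have "even n" "m \<le> n"
    by (auto simp: n_def)
  have up: "((q + (n - d)) mod n + d) mod n = q" and down: "((q + d) mod n + (n - d)) mod n = q"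
    if "d \<le> n" "q < n" for q d
  proof -
    have "q + (n - d) + d = q + n" "q + d + (n - d) = q + n"
      using that by auto
    then show "((q + (n - d)) mod n + d) mod n = q" "((q + d) mod n + (n - d)) mod n = q"
      using \<open>q < n\<close> by (simp_all only: mod_add_left_eq mod_add_self2 mod_less)
  qed
  \<comment> \<open>The direction of a path depends on the parity of its number, which reduction
    modulo the even \<open>n\<close> preserves.\<close>
  have parity: "even (a mod n) \<longleftrightarrow> even a" for a
    using \<open>even n\<close> by (simp add: dvd_mod_iff)
  have "\<exists>D. is_decomposition (path_graph (2 * m)) (complete_bipartite (2 * m - 1) n) D"
  proof (rule complete_bipartite_path_decompositionI[where \<alpha> = \<alpha> and \<beta> = \<beta>])
    show "inj_on (\<alpha> p) {..<m}" for p
      by (auto simp: \<alpha>_def inj_on_def)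
    show "inj_on (\<beta> p) {..<m}" for p
    proof (rule inj_on_subset)
      show "inj_on (\<beta> p) {..<n}"
        using inj_on_add_mod[of p n] inj_on_diff_mod[of p n] by (cases "even p") (simp_all add: \<beta>_def[abs_def])
    qed (use \<open>m \<le> n\<close> in auto)
    show "\<exists>p<n. \<exists>j. j < m \<and> \<alpha> p j = i \<and> \<beta> p j = q \<or> Suc j < m \<and> \<alpha> p (Suc j) = i \<and> \<beta> p j = q"
      if i: "i < 2 * m - 1" and q: "q < n" for i q
    proof -
      \<comment> \<open>Apart from the common start \<open>m - 1\<close>, vertex \<open>i\<close> is
        visited at position \<open>Suc d\<close>, by the even paths if it lies below and by the odd
        ones if above.\<close>
      consider "i = m - 1" | d where "i = m - Suc (Suc d)" "Suc d < m" | d where "i = m + d" "Suc d < m"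
      proof -
        have "i = m - Suc (Suc (m - 2 - i)) \<and> Suc (m - 2 - i) < m" if "i < m - 1"
          using that by auto
        moreover have "i = m + (i - m) \<and> Suc (i - m) < m" if "m \<le> i"
          using that i by auto
        moreover have "i < m - 1 \<or> i = m - 1 \<or> m \<le> i"
          by auto
        ultimately show thesis
          using that by blast
      qed
      then show ?thesis
      proof cases
        case 1
        then show ?thesis
          using q \<open>0 < m\<close> by (intro exI[of _ q] conjI exI[of _ 0]) (auto simp: \<alpha>_def \<beta>_def)
      next
        case (2 d)
        have "d \<le> n" "Suc d \<le> n"
          using 2 \<open>m \<le> n\<close> by auto
        \<comment> \<open>An ascending path started at \<open>p j\<close> meets \<open>q\<close> at
          position \<open>j\<close>. Exactly one of \<open>p d\<close> and \<open>p (Suc d)\<close>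
          is even; on its path \<open>q\<close> comes just before or just after \<open>i\<close>,
          respectively.\<close>
        define p where "p j = (q + (n - j)) mod n" for j
        have p: "p j < n" for j
          using q by (simp add: p_def)
        show ?thesis
        proof (cases "even (q + d)")
          case True
          then have "even (p d)"
            using \<open>even n\<close> \<open>d \<le> n\<close> by (simp add: p_def parity)
          then have "\<alpha> (p d) (Suc d) = i" "\<beta> (p d) d = q"
            using 2 up[of d q] q \<open>d \<le> n\<close> by (simp_all add: \<alpha>_def \<beta>_def p_def)
          with p 2 show ?thesis by blast
        next
          case False
          then have "even (p (Suc d))"
            using \<open>even n\<close> \<open>Suc d \<le> n\<close> by (simp add: p_def parity)
          then have "\<alpha> (p (Suc d)) (Suc d) = i" "\<beta> (p (Suc d)) (Suc d) = q"
            using 2 up[of "Suc d" q] q \<open>Suc d \<le> n\<close> by (simp_all add: \<alpha>_def \<beta>_def p_def)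
          with p 2 show ?thesis by blast
        qed
      next
        case (3 d)
        have "d \<le> n" "Suc d \<le> n"
          using 3 \<open>m \<le> n\<close> by auto
        \<comment> \<open>Mirror image of the previous case, with descending odd paths.\<close>
        define p where "p j = (q + j) mod n" for j
        have p: "p j < n" for j
          using q by (simp add: p_def)
        show ?thesis
        proof (cases "even (q + d)")
          case False
          then have "odd (p d)"
            by (simp add: p_def parity)
          then have "\<alpha> (p d) (Suc d) = i" "\<beta> (p d) d = q"
            using 3 down[of d q] q \<open>d \<le> n\<close> by (simp_all add: \<alpha>_def \<beta>_def p_def)
          with p 3 show ?thesis by blast
        next
          case True
          then have "odd (p (Suc d))"
            by (simp add: p_def parity)
          then have "\<alpha> (p (Suc d)) (Suc d) = i" "\<beta> (p (Suc d)) (Suc d) = q"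
            using 3 down[of "Suc d" q] q \<open>Suc d \<le> n\<close> by (simp_all add: \<alpha>_def \<beta>_def p_def)
          with p 3 show ?thesis by blast
        qed
      qed
    qed
  qed (use \<open>0 < m\<close> in \<open>auto simp: \<alpha>_def \<beta>_def n_def\<close>)
  then show ?thesis
    by (simp add: n_def)
qed

section \<open>The case x = k - 2\<close>

lemma complete_bipartite_path_decomposition_diff2:
  assumes "0 < m"
  shows "\<exists>D. is_decomposition (path_graph (2 * m)) (complete_bipartite (2 * m - 1) (2 * m - 2)) D"
proof -
  define n where "n = 2 * m - 2"
  \<comment> \<open>Index \<open>n\<close> is the additional vertex, where every path starts. After
    that, the indices of an edge add up to \<open>2 * p\<close> or \<open>2 * p + 1\<close> modulo
    \<open>n\<close>, so \<open>p\<close> and \<open>p + (m - 1)\<close> give the two halves of one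
    cycle.\<close>
  define \<alpha> where "\<alpha> p j = (case j of 0 \<Rightarrow> n | Suc j \<Rightarrow> (p + (n - j)) mod n)" for p j :: nat
  define \<beta> where "\<beta> p j = (p + j) mod n" for p j :: nat
  have k: "2 * m - 1 = Suc n"
    using \<open>0 < m\<close> by (simp add: n_def)
  have "\<exists>D. is_decomposition (path_graph (2 * m)) (complete_bipartite (2 * m - 1) n) D"
  proof (rule complete_bipartite_path_decompositionI[where \<alpha> = \<alpha> and \<beta> = \<beta>])
    fix p
    assume "p < n"
    \<comment> \<open>For \<open>m = 1\<close> there are no paths; \<open>p < n\<close> forces
      \<open>m\<close> to be at least 2.\<close>
    then have "m \<le> n"
      by (auto simp: n_def)
    have \<alpha>_Suc: "\<alpha> p (Suc j) < n" for j
      using \<open>p < n\<close> by (simp add: \<alpha>_def)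
    show "inj_on (\<alpha> p) {..<m}"
    proof (rule inj_onI)
      fix i j
      assume ij: "i \<in> {..<m}" "j \<in> {..<m}" "\<alpha> p i = \<alpha> p j"
      show "i = j"
      proof (cases "i = 0 \<or> j = 0")
        case True
        then show ?thesis
          using ij(3) \<alpha>_Suc[of "i - 1"] \<alpha>_Suc[of "j - 1"] by (cases i; cases j) (auto simp: \<alpha>_def)
      next
        case False
        then obtain i' j' where "i = Suc i'" "j = Suc j'"
          by (metis not0_implies_Suc)
        with ij \<open>m \<le> n\<close> inj_onD[OF inj_on_diff_mod[of p n], of i' j'] show ?thesis
          by (simp add: \<alpha>_def)
      qed
    qed
    show "inj_on (\<beta> p) {..<m}"
      using inj_on_subset[OF inj_on_add_mod[of p n], of "{..<m}"] \<open>m \<le> n\<close> by (simp add: \<beta>_def[abs_def])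
    show "\<alpha> p j < 2 * m - 1" for j
    proof (cases j)
      case 0
      then show ?thesis
        unfolding k by (simp add: \<alpha>_def)
    next
      case (Suc j')
      then show ?thesis
        using \<alpha>_Suc[of j'] unfolding k by simp
    qed
    show "\<beta> p j < n" for j
      using \<open>p < n\<close> by (simp add: \<beta>_def)
  next
    fix i q
    assume "i < 2 * m - 1" and q: "q < n"
    then consider "i = n" | "i < n"
      unfolding k by linarith
    then show "\<exists>p<n. \<exists>j. j < m \<and> \<alpha> p j = i \<and> \<beta> p j = q \<or> Suc j < m \<and> \<alpha> p (Suc j) = i \<and> \<beta> p j = q"
    proof cases
      case 1
      with q \<open>0 < m\<close> show ?thesis
        by (intro exI[of _ q] conjI exI[of _ 0]) (auto simp: \<alpha>_def \<beta>_def)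
    next
      case 2
      \<comment> \<open>Path \<open>p\<close> must satisfy \<open>p - j = i\<close> and either
        \<open>p + j = q\<close> or \<open>p + j + 1 = q\<close> modulo \<open>n\<close>. Hence
        \<open>q - i\<close> is \<open>2 * j\<close> or \<open>2 * j + 1\<close>, and
        \<open>j\<close> is half of it, rounded down.\<close>
      define d where "d = (q + (n - i)) mod n"
      define j where "j = d div 2"
      define p where "p = (i + j) mod n"
      have "d < n"
        using q by (simp add: d_def)
      then have j: "Suc j < m" "j \<le> n" and "p < n"
        using q by (auto simp: j_def n_def p_def)
      have "\<alpha> p (Suc j) = (i + j + (n - j)) mod n"
        by (simp add: \<alpha>_def p_def mod_simps)
      also have "i + j + (n - j) = i + n"
        using \<open>j \<le> n\<close> by simp
      finally have \<alpha>: "\<alpha> p (Suc j) = i"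
        using 2 by simp
      have "(i + d) mod n = (i + (q + (n - i))) mod n"
        by (simp add: d_def mod_simps)
      also have "i + (q + (n - i)) = q + n"
        using 2 by simp
      finally have "(i + d) mod n = q"
        using q by simp
      moreover have "\<beta> p j' = (i + (j + j')) mod n" for j'
        by (simp add: \<beta>_def p_def mod_simps add.assoc)
      moreover have "j + j = d \<or> j + Suc j = d"
        unfolding j_def by presburger
      ultimately have "\<beta> p j = q \<or> \<beta> p (Suc j) = q"
        by metis
      with \<alpha> j \<open>p < n\<close> show ?thesis
        by blast
    qed
  qed (fact \<open>0 < m\<close>)
  then show ?thesis
    by (simp add: n_def)
qed

theorem proposition2p1:
  fixes k x :: nat
  assumes "2 \<le> k" and "even k" and "x \<in> {k - 2, k}"
  shows "\<exists>D. is_decomposition (path_graph k) (complete_bipartite (k - 1) x) D"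
proof -
  obtain m where "k = 2 * m"
    using \<open>even k\<close> ..
  with assms complete_bipartite_path_decomposition[of m] complete_bipartite_path_decomposition_diff2[of m] show ?thesis
    by auto
qed

end
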